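(* Let $\bar w\sim\mathcal{N}(0,I)$, let $M$ be a symmetric positive semidefinite real matrix of size $(N+1)n+Nm$, let $T^x\in\mathbb{R}^{1\times(N+1)n}$, $T^u\in\mathbb{R}^{1\times Nm}$, $y\in\mathbb{R}$, $\beta>0$, and let $\varphi(z)=0$ if $z\le 0$ and $\varphi(z)=z$ otherwise, for $z\in\mathbb{R}$. The problem $$\min_{\theta\in\Theta}\ \mathbb{E}\left[\begin{bmatrix}\bar x_\theta^T&\bar u_\theta^T\end{bmatrix}M\begin{bmatrix}\bar x_\theta\\ \bar u_\theta\end{bmatrix}\right]\quad\text{subject to}\quad\mathbb{E}[\varphi(T^x\bar x_\theta+T^u\bar u_\theta-y)]\le\beta$$ is equivalent to $$\text{minimize}\ \ h_1(\bar d)+h_2(\bar G)\quad\text{subject to}\quad\sigma\, g\Big(\frac{\mu}{\sigma}\Big)\le\beta$$ (over $\theta=(\bar G,\bar d)\in\Theta$), where $$\mu=(T^x\bar A x_0-y)+(T^x\bar B+T^u)\bar d,\qquad\sigma=\big\|(T^x\bar D+(T^x\bar B+T^u)\bar G)^T\big\|_2,$$ $$h_1(\bar d)=\begin{bmatrix}(\bar A x_0+\bar B\bar d)^T&\bar d^T\end{bmatrix}M\begin{bmatrix}\bar A x_0+\bar B\bar d\\ \bar d\end{bmatrix},\qquad h_2(\bar G)=\mathrm{Tr}\left(\begin{bmatrix}(\bar B\bar G+\bar D)^T&\bar G^T\end{bmatrix}M\begin{bmatrix}\bar B\bar G+\bar D\\ \bar G\end{bmatrix}\right),$$ and $g(x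)=\frac{x}{2}\mathrm{erfc}\big(\frac{-x}{\sqrt2}\big)+\frac{1}{\sqrt{2\pi}}\exp\big(\frac{-x^2}{2}\big)$.
   Context: Let $n,m,N\ge 1$ be integers, $A\in\mathbb{R}^{n\times n}$, $B\in\mathbb{R}^{n\times m}$, $x_0\in\mathbb{R}^n$, and let $w(0),\dots,w(N-1)$ be $\mathbb{R}^n$-valued random vectors on a probability space $(\Omega,\mathfrak{F},\mathbb{P})$, stacked into $\bar w\in\mathbb{R}^{Nn}$. The linear system $x(t+1)=Ax(t)+Bu(t)+w(t)$, $x(0)=x_0$, is written over $t=0,\dots,N$ as $\bar x=\bar A x_0+\bar B\bar u+\bar D\bar w$, where $\bar x\in\mathbb{R}^{(N+1)n}$ stacks $x(0),\dots,x(N)$ and $\bar u\in\mathbb{R}^{Nm}$ stacks $u(0),\dots,u(N-1)$; $\bar A$ stacks $I_n,A,\dots,A^N$; $\bar B$ is the $(N+1)n\times Nm$ matrix whose $n\times m$ block in position $(t,s)$, $0\le t\le N$, $0\le s\le N-1$, is $A^{t-1-s}B$ if $s<t$ and $0$ otherwise; $\bar D$ is the $(N+1)n\times Nn$ matrix whose $n\times n$ block $(t,s)$ is $A^{t-1-s}$ if $s<t$ and $0$ otherwise. $\Theta$ is the linear space of parameters $\theta=(\bar G,\bar d)$ with $\bar d\in\mathbb{R}^{Nm}$ and $\bar G\in\mathbb{R}^{Nm\times Nn}$ strictly block lower triangular (its $m\times n$ block $(t,i)$, $0\le t,i\le N-1$, vanishes whenever $i\ge t$). For $\theta\in\Theta$,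 $\bar u_\theta=\bar G\bar w+\bar d$ and $\bar x_\theta=\bar A x_0+\bar B(\bar G\bar w+\bar d)+\bar D\bar w$. $\mathbb{E}$ is expectation with respect to $\mathbb{P}$, and $\mathrm{erfc}(x)=1-\mathrm{erf}(x)$ with $\mathrm{erf}(x)=\frac{2}{\sqrt\pi}\int_0^xe^{-u^2}du$.
   Formalization: Where σ = 0 (e.g. when T^x = 0 and T^u = 0) the expression σ g(μ/σ) is undefined; it is read there as its limit as σ decreases to 0, that is, as max(μ, 0). *)

theory Defs
  imports "HOL-Probability.Probability" "Jordan_Normal_Form.Matrix"
begin

definition block_mat :: "nat \<Rightarrow> nat \<Rightarrow> nat \<Rightarrow> nat \<Rightarrow> (nat \<Rightarrow> nat \<Rightarrow> real mat) \<Rightarrow> real mat" where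
  "block_mat p q r c F = mat (p * r) (q * c) (\<lambda>(i, j). F (i div r) (j div c) $$ (i mod r, j mod c))"

definition stack_vec :: "nat \<Rightarrow> nat \<Rightarrow> (nat \<Rightarrow> real vec) \<Rightarrow> real vec" where
  "stack_vec p r v = vec (p * r) (\<lambda>i. v (i div r) $ (i mod r))"

definition Abar :: "nat \<Rightarrow> nat \<Rightarrow> real mat \<Rightarrow> real mat" where
  "Abar n N A = block_mat (N + 1) 1 n n (\<lambda>t _. A ^\<^sub>m t)"

definition Bbar :: "nat \<Rightarrow> nat \<Rightarrow> nat \<Rightarrow> real mat \<Rightarrow> real mat \<Rightarrow> real mat" where
  "Bbar n m N A B = block_mat (N + 1) N n m
     (\<lambda>t s. if s < t then A ^\<^sub>m (t - 1 - s) * B else 0\<^sub>m n m)"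

definition Dbar :: "nat \<Rightarrow> nat \<Rightarrow> real mat \<Rightarrow> real mat" where
  "Dbar n N A = block_mat (N + 1) N n n
     (\<lambda>t s. if s < t then A ^\<^sub>m (t - 1 - s) else 0\<^sub>m n n)"

definition strictly_block_lower :: "nat \<Rightarrow> nat \<Rightarrow> nat \<Rightarrow> real mat \<Rightarrow> bool" where
  "strictly_block_lower n m N G \<longleftrightarrow>
     (\<forall>t<N. \<forall>i<N. t \<le> i \<longrightarrow> (\<forall>a<m. \<forall>b<n. G $$ (t * m + a, i * n + b) = 0))"

definition Theta :: "nat \<Rightarrow> nat \<Rightarrow> nat \<Rightarrow> (real mat \<times> real vec) set" where
  "Theta n m N = {(G, d). G \<in> carrier_mat (N * m) (N * n) \<and> d \<in> carrier_vec (N * m)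
     \<and> strictly_block_lower n m N G}"

definition u_theta :: "real mat \<times> real vec \<Rightarrow> real vec \<Rightarrow> real vec" where
  "u_theta \<theta> w = fst \<theta> *\<^sub>v w + snd \<theta>"

definition x_theta ::
  "nat \<Rightarrow> nat \<Rightarrow> nat \<Rightarrow> real mat \<Rightarrow> real mat \<Rightarrow> real vec \<Rightarrow> real mat \<times> real vec \<Rightarrow> real vec \<Rightarrow> real vec" where
  "x_theta n m N A B x0 \<theta> w =
     Abar n N A *\<^sub>v x0 + Bbar n m N A B *\<^sub>v u_theta \<theta> w + Dbar n N A *\<^sub>v w"

definition sym_psd :: "nat \<Rightarrow> real mat \<Rightarrow> bool" where
  "sym_psd k M \<longleftrightarrow> M \<in> carrier_mat k k \<and> transpose_mat M = M
     \<and> (\<forall>v\<in>carrier_vec k. 0 \<le> v \<bullet> (M *\<^sub>v v))"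

definition quad_form :: "real mat \<Rightarrow> real vec \<Rightarrow> real" where
  "quad_form M z = z \<bullet> (M *\<^sub>v z)"

definition mat_trace :: "real mat \<Rightarrow> real" where
  "mat_trace X = (\<Sum>i<dim_row X. X $$ (i, i))"

definition l2norm_vec :: "real vec \<Rightarrow> real" where
  "l2norm_vec v = sqrt (\<Sum>i<dim_vec v. (v $ i)\<^sup>2)"

text \<open>
  The law \<open>N(0, I)\<close> on k-dimensional space, given by its Lebesgue density. The type \<open>real vec\<close>
  carries no sigma-algebra, so a random vector is identified with its coordinate function in the
  product space over \<open>{..<k}\<close>; being \<open>distributed\<close> includes measurability.
\<close>
definition std_normal_vec :: "'a measure \<Rightarrow> nat \<Rightarrow> ('a \<Rightarrow> real vec) \<Rightarrow> bool" where
  "std_normal_vec P k X \<longleftrightarrow>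
     (\<forall>\<omega>\<in>space P. X \<omega> \<in> carrier_vec k) \<and>
     distributed P (Pi\<^sub>M {..<k} (\<lambda>_. lborel)) (\<lambda>\<omega>. \<lambda>i\<in>{..<k}. X \<omega> $ i)
       (\<lambda>x. ennreal (exp (- (\<Sum>i<k. (x i)\<^sup>2) / 2) / sqrt ((2 * pi) ^ k)))"

definition phi :: "real \<Rightarrow> real" where
  "phi z = (if z \<le> 0 then 0 else z)"

text \<open>The interval integral is oriented, so this is the odd function erf also for negative arguments.\<close>
definition erf :: "real \<Rightarrow> real" where
  "erf x = 2 / sqrt pi * (LBINT u=0..ereal x. exp (- u\<^sup>2))"

definition erfc :: "real \<Rightarrow> real" where
  "erfc x = 1 - erf x"

definition g_fun :: "real \<Rightarrow> real" where
  "g_fun x = x / 2 * erfc (- x / sqrt 2) + 1 / sqrt (2 * pi) * exp (- x\<^sup>2 / 2)"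

text \<open>
  The expression \<open>\<sigma> g(\<mu> / \<sigma>)\<close>. At \<open>\<sigma> = 0\<close> it is read as its limit for \<open>\<sigma>\<close> decreasing to 0
  (the usual closure of a perspective function); the HOL convention \<open>\<mu> / 0 = 0\<close> would make it 0
  there, also for positive \<open>\<mu>\<close>.
\<close>
definition sigma_g :: "real \<Rightarrow> real \<Rightarrow> real" where
  "sigma_g \<mu> \<sigma> = (if \<sigma> = 0 then Lim (at_right 0) (\<lambda>s. s * g_fun (\<mu> / s))
     else \<sigma> * g_fun (\<mu> / \<sigma>))"

definition cost ::
  "nat \<Rightarrow> nat \<Rightarrow> nat \<Rightarrow> real mat \<Rightarrow> real mat \<Rightarrow> real vec \<Rightarrow> real mat \<Rightarrow> real mat \<times> real vec \<Rightarrow> real vec \<Rightarrow> real" where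
  "cost n m N A B x0 M \<theta> w = quad_form M (x_theta n m N A B x0 \<theta> w @\<^sub>v u_theta \<theta> w)"

text \<open>Row vectors are matrices with one row; a product of size one is turned into a number by \<open>$ 0\<close>.\<close>
definition violation ::
  "nat \<Rightarrow> nat \<Rightarrow> nat \<Rightarrow> real mat \<Rightarrow> real mat \<Rightarrow> real vec \<Rightarrow> real mat \<Rightarrow> real mat \<Rightarrow> real
   \<Rightarrow> real mat \<times> real vec \<Rightarrow> real vec \<Rightarrow> real" where
  "violation n m N A B x0 Tx Tu y \<theta> w =
     phi ((Tx *\<^sub>v x_theta n m N A B x0 \<theta> w) $ 0 + (Tu *\<^sub>v u_theta \<theta> w) $ 0 - y)"

definition mu_fun ::
  "nat \<Rightarrow> nat \<Rightarrow> nat \<Rightarrow> real mat \<Rightarrow> real mat \<Rightarrow> real vec \<Rightarrow> real mat \<Rightarrow> real mat \<Rightarrow> real \<Rightarrow> real vec \<Rightarrow> real" where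
  "mu_fun n m N A B x0 Tx Tu y d =
     (((Tx * Abar n N A) *\<^sub>v x0) $ 0 - y) + ((Tx * Bbar n m N A B + Tu) *\<^sub>v d) $ 0"

definition sigma_fun ::
  "nat \<Rightarrow> nat \<Rightarrow> nat \<Rightarrow> real mat \<Rightarrow> real mat \<Rightarrow> real mat \<Rightarrow> real mat \<Rightarrow> real mat \<Rightarrow> real" where
  "sigma_fun n m N A B Tx Tu G =
     l2norm_vec (col (transpose_mat (Tx * Dbar n N A + (Tx * Bbar n m N A B + Tu) * G)) 0)"

definition h1 ::
  "nat \<Rightarrow> nat \<Rightarrow> nat \<Rightarrow> real mat \<Rightarrow> real mat \<Rightarrow> real vec \<Rightarrow> real mat \<Rightarrow> real vec \<Rightarrow> real" where
  "h1 n m N A B x0 M d = quad_form M ((Abar n N A *\<^sub>v x0 + Bbar n m N A B *\<^sub>v d) @\<^sub>v d)"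

definition h2 ::
  "nat \<Rightarrow> nat \<Rightarrow> nat \<Rightarrow> real mat \<Rightarrow> real mat \<Rightarrow> real mat \<Rightarrow> real mat \<Rightarrow> real" where
  "h2 n m N A B M G =
     (let Z = (Bbar n m N A B * G + Dbar n N A) @\<^sub>r G in mat_trace (transpose_mat Z * M * Z))"

text \<open>
  Two problems over the same set \<open>S\<close> of decision variables, with objectives \<open>f\<close>, \<open>f'\<close> and
  constraints \<open>C\<close>, \<open>C'\<close>: same feasible points, same objective at every point of \<open>S\<close>, and
  therefore the same minimizers and the same optimal value (\<open>\<infinity>\<close> if infeasible).
\<close>
definition equiv_min_problems ::
  "'b set \<Rightarrow> ('b \<Rightarrow> real) \<Rightarrow> ('b \<Rightarrow> bool) \<Rightarrow> ('b \<Rightarrow> real) \<Rightarrow> ('b \<Rightarrow> bool) \<Rightarrow> bool" where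
  "equiv_min_problems S f C f' C' \<longleftrightarrow>
     (\<forall>\<theta>\<in>S. C \<theta> \<longleftrightarrow> C' \<theta>) \<and>
     (\<forall>\<theta>\<in>S. f \<theta> = f' \<theta>) \<and>
     (\<forall>\<theta>. is_arg_min f (\<lambda>\<theta>. \<theta> \<in> S \<and> C \<theta>) \<theta> \<longleftrightarrow> is_arg_min f' (\<lambda>\<theta>. \<theta> \<in> S \<and> C' \<theta>) \<theta>) \<and>
     (INF \<theta>\<in>{\<theta>\<in>S. C \<theta>}. ereal (f \<theta>)) = (INF \<theta>\<in>{\<theta>\<in>S. C' \<theta>}. ereal (f' \<theta>))"

end

theory Submission
  imports Defs "HOL-Real_Asymp.Real_Asymp"
begin

text \<open>
  For a fixed parameter \<open>\<theta> = (G, d)\<close> every quantity is an affine function of the noise: the stacked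
  vector of states and inputs is \<open>c + Z w\<close> with \<open>c\<close> depending on \<open>d\<close> and \<open>Z\<close> on \<open>G\<close> only, and the
  constrained scalar is \<open>\<mu> + r \<bullet> w\<close> with \<open>r\<close> of Euclidean norm \<open>\<sigma>\<close>
  (\<open>state_input_affine\<close>, \<open>constraint_affine\<close>). So the two problems have the same objective and the
  same constraint function at each \<open>\<theta>\<close>, for two independent reasons.

  Objective: the coordinates of \<open>w\<close> are centred and uncorrelated with unit variance, so the
  expectation of a quadratic form at \<open>c + Z w\<close> is its value at \<open>c\<close> plus the sum of its values at the
  columns of \<open>Z\<close>, a trace (\<open>has_bochner_integral_quad_form_affine\<close>).

  Constraint: if \<open>\<sigma> > 0\<close> then \<open>r \<bullet> w / \<sigma>\<close> is a standard normal variable \<open>U\<close>, because sums of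
  independent normal variables are normal. Positive homogeneity of \<open>phi\<close> turns \<open>phi (\<mu> + \<sigma> U)\<close> into
  \<open>\<sigma> phi (\<mu> / \<sigma> + U)\<close>, and \<open>g\<close> is precisely the mean of \<open>phi (x + U)\<close>
  (\<open>has_bochner_integral_phi_std_normal\<close>, from an explicit antiderivative). If \<open>\<sigma> = 0\<close> the scalar is
  the constant \<open>\<mu>\<close>, so what is needed is that \<open>s g (\<mu> / s)\<close> tends to \<open>phi \<mu>\<close> as \<open>s\<close> decreases to 0.
  It does, because \<open>s g (\<mu> / s)\<close> is the mean of \<open>phi (\<mu> + s U)\<close> and \<open>phi\<close> is 1-Lipschitz (\<open>sigma_g_0\<close>).
\<close>

text \<open>
  The symbols \<open>$\<close> and \<open>\<bullet>\<close> would otherwise be ambiguous between \<open>real vec\<close> and the types \<open>real ^ 'n\<close>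
  and inner product spaces.
\<close>

unbundle no vec_syntax and no inner_syntax

section \<open>The positive part of a shifted normal variable\<close>

lemma erf_has_real_derivative:
  "(erf has_real_derivative 2 / sqrt pi * exp (- x\<^sup>2)) (at x)"
proof -
  \<comment> \<open>Any interval with \<open>0\<close> and \<open>x\<close> in its interior.\<close>
  let ?a = "- \<bar>x\<bar> - 1" and ?b = "\<bar>x\<bar> + 1"
  have "((\<lambda>u. LBINT y=ereal 0..ereal u. exp (- y\<^sup>2)) has_vector_derivative exp (- x\<^sup>2)) (at x within {?a..?b})"
    by (rule interval_integral_FTC2) (auto intro!: continuous_intros)
  moreover have "at x within {?a..?b} = at x"
    by (rule at_within_Icc_at) auto
  ultimately have "((\<lambda>u. LBINT y=ereal 0..ereal u. exp (- y\<^sup>2)) has_real_derivative exp (- x\<^sup>2)) (at x)"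
    by (simp add: has_real_derivative_iff_has_vector_derivative)
  from DERIV_cmult[OF this, of "2 / sqrt pi"] show ?thesis
    by (simp add: erf_def[abs_def] zero_ereal_def)
qed

text \<open>This is the Gaussian integral over the half line, rescaled.\<close>

lemma erf_tendsto_1: "(erf \<longlongrightarrow> 1) at_top"
proof -
  let ?f = "\<lambda>x::real. indicator {0..} x *\<^sub>R exp (- x\<^sup>2)"
  have "((\<lambda>y. \<integral>x. indicator {..y} x *\<^sub>R ?f x \<partial>lborel) \<longlongrightarrow> (\<integral>x. ?f x \<partial>lborel)) at_top"
    using gaussian_moment_0 by (intro tendsto_integral_at_top) (auto simp: has_bochner_integral_iff)
  also have "(\<integral>x. ?f x \<partial>lborel) = sqrt pi / 2"
    using gaussian_moment_0 by (rule has_bochner_integral_integral_eq)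
  finally have "((\<lambda>y. \<integral>x. indicator {..y} x *\<^sub>R ?f x \<partial>lborel) \<longlongrightarrow> sqrt pi / 2) at_top" .
  then have "((\<lambda>y. 2 / sqrt pi * (\<integral>x. indicator {..y} x *\<^sub>R ?f x \<partial>lborel)) \<longlongrightarrow> 2 / sqrt pi * (sqrt pi / 2)) at_top"
    by (intro tendsto_intros)
  moreover have "\<forall>\<^sub>F y in at_top. 2 / sqrt pi * (\<integral>x. indicator {..y} x *\<^sub>R ?f x \<partial>lborel) = erf y"
    using eventually_ge_at_top[of 0]
  proof eventually_elim
    case (elim y)
    have "(LBINT u=0..ereal y. exp (- u\<^sup>2)) = (LBINT u:{0..y}. exp (- u\<^sup>2))"
      using interval_integral_Icc[of 0 y "\<lambda>u. exp (- u\<^sup>2)"] elim by (simp add: zero_ereal_def)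
    also have "\<dots> = (\<integral>x. indicator {..y} x *\<^sub>R ?f x \<partial>lborel)"
      unfolding set_lebesgue_integral_def
      by (intro Bochner_Integration.integral_cong) (auto split: split_indicator)
    finally show ?case by (simp add: erf_def)
  qed
  ultimately show ?thesis by (simp add: filterlim_cong)
qed

text \<open>
  On the half line \<open>z \<ge> - x\<close>, where \<open>phi (x + z) = x + z\<close>, the integrand has the antiderivative
  \<open>x / 2 * erf (z / sqrt 2) - std_normal_density z\<close>: the first term accounts for \<open>x\<close>, the second
  for \<open>z\<close>, as the normal density solves \<open>\<phi>' z = - z * \<phi> z\<close>.
\<close>

lemma has_bochner_integral_phi_std_normal:
  "has_bochner_integral lborel (\<lambda>z. std_normal_density z * phi (x + z)) (g_fun x)"
proof -
  let ?F = "\<lambda>z. x / 2 * erf (z / sqrt 2) - std_normal_density z"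
  have sq: "(z / sqrt 2)\<^sup>2 = z\<^sup>2 / 2" for z :: real
    by (simp add: power_divide)
  have sqrt2: "sqrt 2 * (sqrt 2 * t) = 2 * t" for t :: real
    by (simp add: mult.assoc[symmetric])
  have D: "(?F has_real_derivative (x + z) * std_normal_density z) (at z)" for z
    unfolding std_normal_density_def
    by (auto intro!: derivative_eq_intros DERIV_chain2[OF erf_has_real_derivative]
        simp: sq sqrt2 field_simps real_sqrt_mult)
  have L: "(?F \<longlongrightarrow> x / 2 * 1 - 0) at_top"
  proof (intro tendsto_intros)
    show "((\<lambda>z. erf (z / sqrt 2)) \<longlongrightarrow> 1) at_top"
      by (rule filterlim_compose[OF erf_tendsto_1]) real_asymp
    show "(std_normal_density \<longlongrightarrow> 0) at_top"
      unfolding std_normal_density_def by real_asymp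
  qed
  have "(\<integral>\<^sup>+z. ennreal (std_normal_density z * phi (x + z)) \<partial>lborel)
      = (\<integral>\<^sup>+z. ennreal ((x + z) * std_normal_density z) * indicator {-x ..} z \<partial>lborel)"
    by (intro nn_integral_cong) (auto simp: phi_def mult.commute split: split_indicator)
  also have "\<dots> = ennreal (x / 2 * 1 - 0 - ?F (- x))"
    by (rule nn_integral_FTC_atLeast[OF _ D _ L]) auto
  also have "x / 2 * 1 - 0 - ?F (- x) = g_fun x"
    by (simp add: g_fun_def erfc_def std_normal_density_def algebra_simps)
  finally have eq: "(\<integral>\<^sup>+z. ennreal (std_normal_density z * phi (x + z)) \<partial>lborel) = ennreal (g_fun x)" .
  \<comment> \<open>The equation between extended integrals above truncates at 0, so the sign of \<open>g_fun x\<close> is needed.\<close>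
  have "?F (- x) \<le> x / 2 * 1 - 0"
  proof (rule tendsto_lowerbound[OF L])
    show "\<forall>\<^sub>F z in at_top. ?F (- x) \<le> ?F z"
      using eventually_ge_at_top[of "- x"]
    proof eventually_elim
      case (elim z)
      then show ?case
        using D by (intro DERIV_nonneg_imp_nondecreasing[of "-x" z ?F]) (auto intro!: exI mult_nonneg_nonneg)
    qed
  qed simp
  then have "0 \<le> g_fun x"
    by (simp add: g_fun_def erfc_def std_normal_density_def algebra_simps)
  with eq show ?thesis
    by (intro has_bochner_integral_nn_integral) (auto simp: phi_def[abs_def])
qed

text \<open>Positive homogeneity of \<open>phi\<close> moves the scale \<open>s\<close> outside.\<close>

lemma has_bochner_integral_phi_normal:
  assumes "0 < s"
  shows "has_bochner_integral lborel (\<lambda>z. std_normal_density z * phi (\<mu> + s * z)) (s * g_fun (\<mu> / s))"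
proof -
  have "phi (\<mu> + s * z) = s * phi (\<mu> / s + z)" for z
  proof -
    have "\<mu> + s * z = s * (\<mu> / s + z)" using assms by (simp add: field_simps)
    then show ?thesis using assms by (auto simp: phi_def mult_le_0_iff)
  qed
  then have "(\<lambda>z. std_normal_density z * phi (\<mu> + s * z)) = (\<lambda>z. s * (std_normal_density z * phi (\<mu> / s + z)))"
    by (simp add: fun_eq_iff)
  then show ?thesis
    using has_bochner_integral_mult_right[OF has_bochner_integral_phi_std_normal[of "\<mu> / s"], of s] by simp
qed

lemma phi_lipschitz: "\<bar>phi a - phi b\<bar> \<le> \<bar>a - b\<bar>"
  by (auto simp: phi_def)

text \<open>
  For a standard normal \<open>U\<close> and \<open>s > 0\<close>, \<open>s * g_fun (\<mu> / s)\<close> is the mean of \<open>phi (\<mu> + s * U)\<close>. By the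
  Lipschitz bound it differs from \<open>phi \<mu>\<close> by at most \<open>s\<close> times the mean of \<open>\<bar>U\<bar>\<close>.
\<close>

lemma sigma_g_0: "sigma_g \<mu> 0 = phi \<mu>"
proof -
  let ?C = "\<integral>z. std_normal_density z * \<bar>z\<bar> \<partial>lborel"
  have bound: "\<bar>s * g_fun (\<mu> / s) - phi \<mu>\<bar> \<le> s * ?C" if "0 < s" for s
  proof -
    note I = has_bochner_integral_phi_normal[OF that, of \<mu>]
    have int1: "integrable lborel (\<lambda>z. std_normal_density z * phi (\<mu> + s * z))"
      using I by (simp add: has_bochner_integral_iff)
    have int2: "integrable lborel (\<lambda>z. std_normal_density z * phi \<mu>)" by simp
    have int3: "integrable lborel (\<lambda>z. std_normal_density z * \<bar>z\<bar>)"
      using integrable_std_normal_moment_abs[of 1] by simp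
    have eq: "s * g_fun (\<mu> / s) - phi \<mu>
        = (\<integral>z. std_normal_density z * phi (\<mu> + s * z) - std_normal_density z * phi \<mu> \<partial>lborel)"
      using I int1 int2 by (simp add: has_bochner_integral_iff)
    have "\<bar>s * g_fun (\<mu> / s) - phi \<mu>\<bar> \<le> (\<integral>z. \<bar>std_normal_density z * phi (\<mu> + s * z) - std_normal_density z * phi \<mu>\<bar> \<partial>lborel)"
      unfolding eq by (rule integral_abs_bound)
    also have "\<dots> \<le> (\<integral>z. s * (std_normal_density z * \<bar>z\<bar>) \<partial>lborel)"
    proof (rule integral_mono)
      fix z :: real
      have "\<bar>phi (\<mu> + s * z) - phi \<mu>\<bar> \<le> \<bar>s * z\<bar>"
        using phi_lipschitz[of "\<mu> + s * z" \<mu>] by simp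
      then have "std_normal_density z * \<bar>phi (\<mu> + s * z) - phi \<mu>\<bar> \<le> std_normal_density z * \<bar>s * z\<bar>"
        by (rule mult_left_mono) simp
      moreover have "\<bar>s * z\<bar> = s * \<bar>z\<bar>"
        using that by (simp add: abs_mult)
      moreover have "\<bar>std_normal_density z * phi (\<mu> + s * z) - std_normal_density z * phi \<mu>\<bar>
          = std_normal_density z * \<bar>phi (\<mu> + s * z) - phi \<mu>\<bar>"
        by (simp only: right_diff_distrib[symmetric] abs_mult) simp
      ultimately show "\<bar>std_normal_density z * phi (\<mu> + s * z) - std_normal_density z * phi \<mu>\<bar>
          \<le> s * (std_normal_density z * \<bar>z\<bar>)"
        by (simp only: mult.left_commute[of s])
    next
      show "integrable lborel (\<lambda>z. \<bar>std_normal_density z * phi (\<mu> + s * z) - std_normal_density z * phi \<mu>\<bar>)"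
        by (intro integrable_abs Bochner_Integration.integrable_diff int1 int2)
      show "integrable lborel (\<lambda>z. s * (std_normal_density z * \<bar>z\<bar>))"
        by (intro integrable_mult_right int3)
    qed
    finally show ?thesis by simp
  qed
  have "((\<lambda>s. s * g_fun (\<mu> / s) - phi \<mu>) \<longlongrightarrow> 0) (at_right 0)"
  proof (rule tendsto_rabs_zero_cancel, rule tendsto_sandwich[of "\<lambda>_. 0"])
    show "((\<lambda>s. s * ?C) \<longlongrightarrow> 0) (at_right 0)"
      by (auto intro!: tendsto_eq_intros)
    show "\<forall>\<^sub>F s in at_right 0. \<bar>s * g_fun (\<mu> / s) - phi \<mu>\<bar> \<le> s * ?C"
      using eventually_at_right_less[of 0] by eventually_elim (rule bound)
  qed auto
  then have "((\<lambda>s. s * g_fun (\<mu> / s)) \<longlongrightarrow> phi \<mu>) (at_right 0)"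
    by (simp add: LIM_zero_iff)
  then show ?thesis
    by (auto simp: sigma_g_def intro!: tendsto_Lim)
qed

section \<open>Standard normal random vectors\<close>

text \<open>
  The density factorizes over the coordinates, so the joint law is the product of one-dimensional
  standard normal laws. A product law means independence, and projecting it gives the marginals.
\<close>

lemma std_normal_vec_indep:
  assumes "prob_space P" and "std_normal_vec P k X"
  shows "prob_space.indep_vars P (\<lambda>_. borel) (\<lambda>i \<omega>. X \<omega> $ i) {..<k}" (is ?indep)
    and "\<And>i. i < k \<Longrightarrow> distributed P lborel (\<lambda>\<omega>. X \<omega> $ i) std_normal_density"
proof -
  interpret prob_space P by fact
  let ?N = "density lborel std_normal_density"
  let ?Q = "Pi\<^sub>M {..<k} (\<lambda>_. lborel :: real measure)"
  let ?f = "\<lambda>x. ennreal (exp (- (\<Sum>i<k. (x i)\<^sup>2) / 2) / sqrt ((2 * pi) ^ k))"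
  have D: "distributed P ?Q (\<lambda>\<omega>. \<lambda>i\<in>{..<k}. X \<omega> $ i) ?f"
    using assms by (simp add: std_normal_vec_def)
  note meas = distributed_measurable[OF D]
  have X: "(\<lambda>\<omega>. X \<omega> $ i) \<in> borel_measurable P" if "i < k" for i
    using measurable_compose[OF meas measurable_component_singleton[of i "{..<k}"]] that by simp
  interpret lb: product_sigma_finite "\<lambda>_::nat. lborel :: real measure" ..
  interpret N: prob_space ?N by (rule prob_space_normal_density) simp
  interpret NN: product_sigma_finite "\<lambda>_::nat. ?N" ..
  have f: "?f x = (\<Prod>i<k. ennreal (std_normal_density (x i)))" for x
  proof -
    have "(\<Prod>i<k. std_normal_density (x i)) = exp (- (\<Sum>i<k. (x i)\<^sup>2) / 2) / sqrt ((2 * pi) ^ k)"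
      unfolding real_sqrt_power
      by (simp add: std_normal_density_def prod.distrib exp_sum[symmetric] sum_negf sum_divide_distrib
          prod_dividef)
    then show ?thesis by (simp add: prod_ennreal)
  qed
  have "distr P ?Q (\<lambda>\<omega>. \<lambda>i\<in>{..<k}. X \<omega> $ i) = density ?Q ?f"
    by (rule distributed_distr_eq_density[OF D])
  also have "\<dots> = Pi\<^sub>M {..<k} (\<lambda>_. ?N)"
  proof (rule NN.PiM_eqI)
    show "sets (density ?Q ?f) = sets (Pi\<^sub>M {..<k} (\<lambda>_. ?N))"
      unfolding sets_density by (intro sets_PiM_cong refl) simp
  next
    fix A :: "nat \<Rightarrow> real set"
    assume A: "\<And>i. i \<in> {..<k} \<Longrightarrow> A i \<in> sets ?N"
    have "emeasure (density ?Q ?f) (Pi\<^sub>E {..<k} A) = (\<integral>\<^sup>+x. ?f x * indicator (Pi\<^sub>E {..<k} A) x \<partial>?Q)"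
      by (rule emeasure_density[OF distributed_borel_measurable[OF D]]) (use A in \<open>auto intro!: sets_PiM_I_finite\<close>)
    also have "\<dots> = (\<integral>\<^sup>+x. (\<Prod>i<k. ennreal (std_normal_density (x i)) * indicator (A i) (x i)) \<partial>?Q)"
    proof (rule nn_integral_cong)
      fix x assume "x \<in> space ?Q"
      then have "(indicator (Pi\<^sub>E {..<k} A) x :: ennreal) = (\<Prod>i<k. indicator (A i) (x i))"
        by (auto simp: space_PiM PiE_iff indicator_def)
      then show "?f x * indicator (Pi\<^sub>E {..<k} A) x
          = (\<Prod>i<k. ennreal (std_normal_density (x i)) * indicator (A i) (x i))"
        by (simp only: f prod.distrib)
    qed
    also have "\<dots> = (\<Prod>i<k. \<integral>\<^sup>+z. ennreal (std_normal_density z) * indicator (A i) z \<partial>lborel)"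
    proof (rule lb.product_nn_integral_prod)
      fix i assume "i \<in> {..<k}"
      then have [measurable]: "A i \<in> sets borel" using A by simp
      show "(\<lambda>z. ennreal (std_normal_density z) * indicator (A i) z) \<in> borel_measurable lborel"
        by measurable
    qed simp
    also have "\<dots> = (\<Prod>i<k. emeasure ?N (A i))"
      using A by (intro prod.cong refl emeasure_density[symmetric]) auto
    finally show "emeasure (density ?Q ?f) (Pi\<^sub>E {..<k} A) = (\<Prod>i\<in>{..<k}. emeasure ?N (A i))" .
  qed simp
  finally have joint: "distr P ?Q (\<lambda>\<omega>. \<lambda>i\<in>{..<k}. X \<omega> $ i) = Pi\<^sub>M {..<k} (\<lambda>_. ?N)" .
  have marg: "distr P lborel (\<lambda>\<omega>. X \<omega> $ i) = ?N" if "i < k" for i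
  proof -
    have "distr P lborel (\<lambda>\<omega>. X \<omega> $ i) = distr P lborel ((\<lambda>x. x i) \<circ> (\<lambda>\<omega>. \<lambda>i\<in>{..<k}. X \<omega> $ i))"
      using that by (intro distr_cong) auto
    also have "\<dots> = distr (distr P ?Q (\<lambda>\<omega>. \<lambda>i\<in>{..<k}. X \<omega> $ i)) lborel (\<lambda>x. x i)"
      using that by (intro distr_distr[symmetric] meas measurable_component_singleton) auto
    also have "\<dots> = distr (Pi\<^sub>M {..<k} (\<lambda>_. ?N)) ?N (\<lambda>x. x i)"
      unfolding joint by (intro distr_cong) auto
    also have "\<dots> = ?N"
      using that N.prob_space_axioms by (intro distr_PiM_component) auto
    finally show ?thesis .
  qed
  show "distributed P lborel (\<lambda>\<omega>. X \<omega> $ i) std_normal_density" if "i < k" for i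
    using marg[OF that] X[OF that] by (simp add: distributed_def)
  show ?indep
  proof (cases "k = 0")
    case True
    then show ?thesis by (simp add: indep_vars_def indep_sets_def)
  next
    case False
    \<comment> \<open>\<open>lborel\<close> and \<open>borel\<close> share their sets, so only the measurable structure is exchanged.\<close>
    have "distr P (Pi\<^sub>M {..<k} (\<lambda>_. borel)) (\<lambda>\<omega>. \<lambda>i\<in>{..<k}. X \<omega> $ i)
        = distr P ?Q (\<lambda>\<omega>. \<lambda>i\<in>{..<k}. X \<omega> $ i)"
      by (intro distr_cong refl sets_PiM_cong) auto
    also have "\<dots> = Pi\<^sub>M {..<k} (\<lambda>i. distr P borel (\<lambda>\<omega>. X \<omega> $ i))"
      unfolding joint
    proof (rule PiM_cong)
      fix i assume "i \<in> {..<k}"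
      then have "?N = distr P lborel (\<lambda>\<omega>. X \<omega> $ i)" using marg by simp
      also have "\<dots> = distr P borel (\<lambda>\<omega>. X \<omega> $ i)" by (intro distr_cong) auto
      finally show "?N = distr P borel (\<lambda>\<omega>. X \<omega> $ i)" .
    qed simp
    finally show ?thesis
      using False X by (subst indep_vars_iff_distr_eq_PiM') auto
  qed
qed

text \<open>The normal law has a density only for positive variance, hence the restriction to the nonzero coefficients.\<close>

lemma std_normal_vec_unit_combination:
  assumes "prob_space P" and X: "std_normal_vec P k X" and a: "(\<Sum>i<k. (a i)\<^sup>2) = 1"
  shows "distributed P lborel (\<lambda>\<omega>. \<Sum>i<k. a i * X \<omega> $ i) std_normal_density"
proof -
  interpret prob_space P by fact
  note indep = std_normal_vec_indep(1)[OF assms(1) X]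
  note normal = std_normal_vec_indep(2)[OF assms(1) X]
  let ?J = "{i\<in>{..<k}. a i \<noteq> 0}"
  have sum_J: "(\<Sum>i<k. (a i)\<^sup>2) = (\<Sum>i\<in>?J. (a i)\<^sup>2)"
    by (rule sum.mono_neutral_right) auto
  have "distributed P lborel (\<lambda>\<omega>. \<Sum>i\<in>?J. a i * X \<omega> $ i)
      (normal_density (\<Sum>i\<in>?J. 0) (sqrt (\<Sum>i\<in>?J. \<bar>a i\<bar>\<^sup>2)))"
  proof (rule sum_indep_normal)
    show "?J \<noteq> {}" using a sum_J by (metis (no_types, lifting) sum.empty zero_neq_one)
    show "indep_vars (\<lambda>i. borel) (\<lambda>i \<omega>. a i * X \<omega> $ i) ?J"
      by (rule indep_vars_compose2[OF indep_vars_subset[OF indep], where Y="\<lambda>i x. a i * x"]) auto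
    fix i assume i: "i \<in> ?J"
    show "distributed P lborel (\<lambda>\<omega>. a i * X \<omega> $ i) (normal_density 0 \<bar>a i\<bar>)"
      using normal_density_affine[OF normal[of i], of "a i" 0] i by simp
  qed auto
  moreover have "(\<Sum>i\<in>?J. a i * X \<omega> $ i) = (\<Sum>i<k. a i * X \<omega> $ i)" for \<omega>
    by (rule sum.mono_neutral_left) auto
  ultimately show ?thesis using a sum_J by simp
qed

text \<open>
  Dividing \<open>r\<close> by its norm reduces the claim to a scalar standard normal variable. For \<open>r = 0\<close> the
  integrand is constant, and the value \<open>phi \<mu>\<close> is what the closure of the perspective gives.
\<close>

lemma has_bochner_integral_phi_std_normal_vec:
  assumes "prob_space P" and X: "std_normal_vec P k X" and r: "r \<in> carrier_vec k"
  shows "has_bochner_integral P (\<lambda>\<omega>. phi (\<mu> + r \<bullet> X \<omega>)) (sigma_g \<mu> (l2norm_vec r))"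
proof -
  interpret prob_space P by fact
  let ?s = "l2norm_vec r"
  have rX: "r \<bullet> X \<omega> = (\<Sum>i<k. r $ i * X \<omega> $ i)" if "\<omega> \<in> space P" for \<omega>
  proof -
    have "dim_vec (X \<omega>) = k" using X that by (auto simp: std_normal_vec_def)
    then show ?thesis by (simp add: scalar_prod_def atLeast0LessThan)
  qed
  have s2: "?s\<^sup>2 = (\<Sum>i<k. (r $ i)\<^sup>2)"
    using r by (auto simp: l2norm_vec_def sum_nonneg)
  have s0: "0 \<le> ?s" by (simp add: l2norm_vec_def sum_nonneg)
  show ?thesis
  proof (cases "?s = 0")
    case True
    then have "r $ i = 0" if "i < k" for i
      using s2 that by (simp add: sum_nonneg_eq_0_iff)
    then have eq: "phi (\<mu> + r \<bullet> X \<omega>) = phi \<mu>" if "\<omega> \<in> space P" for \<omega>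
      using rX[OF that] by simp
    have "has_bochner_integral P (\<lambda>\<omega>. phi \<mu>) (phi \<mu>)"
      by (simp add: has_bochner_integral_iff prob_space)
    from has_bochner_integral_cong[THEN iffD2, OF refl eq refl this] show ?thesis
      using True by (simp add: sigma_g_0)
  next
    case False
    with s0 have s: "0 < ?s" by simp
    let ?Z = "\<lambda>\<omega>. \<Sum>i<k. r $ i / ?s * X \<omega> $ i"
    have "(\<Sum>i<k. (r $ i / ?s)\<^sup>2) = 1"
      using s by (simp add: power_divide sum_divide_distrib[symmetric] s2[symmetric])
    then have Z: "distributed P lborel ?Z std_normal_density"
      by (rule std_normal_vec_unit_combination[OF assms(1) X])
    have [measurable]: "phi \<in> borel_measurable borel"
      unfolding phi_def[abs_def] by measurable
    have m: "(\<lambda>z. phi (\<mu> + ?s * z)) \<in> borel_measurable lborel" by measurable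
    have I: "has_bochner_integral P (\<lambda>\<omega>. phi (\<mu> + ?s * ?Z \<omega>)) (?s * g_fun (\<mu> / ?s))"
      using has_bochner_integral_phi_normal[OF s, of \<mu>] distributed_integral[OF Z m]
        distributed_integrable[OF Z m] unfolding has_bochner_integral_iff by simp
    have "r \<bullet> X \<omega> = ?s * ?Z \<omega>" if "\<omega> \<in> space P" for \<omega>
      unfolding rX[OF that] sum_distrib_left using s by (intro sum.cong refl) simp
    then have "phi (\<mu> + r \<bullet> X \<omega>) = phi (\<mu> + ?s * ?Z \<omega>)" if "\<omega> \<in> space P" for \<omega>
      using that by simp
    moreover have "sigma_g \<mu> ?s = ?s * g_fun (\<mu> / ?s)"
      using s by (simp add: sigma_g_def)
    ultimately show ?thesis
      by (rule has_bochner_integral_cong[THEN iffD2, OF refl _ _ I])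
  qed
qed

lemma std_normal_vec_moments:
  assumes "prob_space P" and X: "std_normal_vec P k X" and "i < k" and "j < k"
  shows "has_bochner_integral P (\<lambda>\<omega>. X \<omega> $ i) 0"
    and "has_bochner_integral P (\<lambda>\<omega>. X \<omega> $ i * X \<omega> $ j) (if i = j then 1 else 0)"
proof -
  interpret prob_space P by fact
  note indep = std_normal_vec_indep(1)[OF assms(1) X]
  note normal = std_normal_vec_indep(2)[OF assms(1) X]
  have mean: "has_bochner_integral P (\<lambda>\<omega>. X \<omega> $ l) 0" if "l < k" for l
    using std_normal_moment_odd[of 0] distributed_integral[OF normal[OF that], of "\<lambda>x. x"]
      distributed_integrable[OF normal[OF that], of "\<lambda>x. x"]
    by (simp add: has_bochner_integral_iff)
  then show "has_bochner_integral P (\<lambda>\<omega>. X \<omega> $ i) 0" using assms by simp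
  show "has_bochner_integral P (\<lambda>\<omega>. X \<omega> $ i * X \<omega> $ j) (if i = j then 1 else 0)"
  proof (cases "i = j")
    case True
    then show ?thesis
      using std_normal_moment_even[of 1] distributed_integral[OF normal[OF \<open>i < k\<close>], of "\<lambda>x. x\<^sup>2"]
        distributed_integrable[OF normal[OF \<open>i < k\<close>], of "\<lambda>x. x\<^sup>2"]
      by (simp add: has_bochner_integral_iff power2_eq_square)
  next
    case False
    have ind: "indep_vars (\<lambda>_. borel) (\<lambda>i \<omega>. X \<omega> $ i) {i, j}"
      using indep_vars_subset[OF indep] assms by auto
    have int: "integrable P (\<lambda>\<omega>. X \<omega> $ l)" if "l \<in> {i, j}" for l
      using mean assms that by (auto simp: has_bochner_integral_iff)
    show ?thesis
      using indep_vars_integrable[OF _ ind int] indep_vars_lebesgue_integral[OF _ ind int] False mean assms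
      by (simp add: has_bochner_integral_iff)
  qed
qed

section \<open>Expected quadratic cost\<close>

lemma quad_form_eq_sum:
  assumes "M \<in> carrier_mat q q" and "v \<in> carrier_vec q"
  shows "quad_form M v = (\<Sum>a<q. \<Sum>b<q. M $$ (a, b) * (v $ a * v $ b))"
proof -
  have "quad_form M v = (\<Sum>a<q. v $ a * (M *\<^sub>v v) $ a)"
    using assms by (simp add: quad_form_def scalar_prod_def atLeast0LessThan)
  also have "\<dots> = (\<Sum>a<q. v $ a * (\<Sum>b<q. M $$ (a, b) * v $ b))"
  proof (intro sum.cong refl)
    fix a assume "a \<in> {..<q}"
    then show "v $ a * (M *\<^sub>v v) $ a = v $ a * (\<Sum>b<q. M $$ (a, b) * v $ b)"
      using assms by (simp add: scalar_prod_def atLeast0LessThan)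
  qed
  also have "\<dots> = (\<Sum>a<q. \<Sum>b<q. M $$ (a, b) * (v $ a * v $ b))"
    unfolding sum_distrib_left by (intro sum.cong refl) (simp only: mult_ac)
  finally show ?thesis .
qed

lemma mat_trace_eq_sum_quad_form:
  assumes M: "M \<in> carrier_mat q q" and Z: "Z \<in> carrier_mat q k"
  shows "mat_trace (transpose_mat Z * M * Z) = (\<Sum>i<k. quad_form M (col Z i))"
proof -
  have "(transpose_mat Z * M * Z) $$ (i, i) = quad_form M (col Z i)" if "i < k" for i
  proof -
    have "(transpose_mat Z * M * Z) = transpose_mat Z * (M * Z)"
      using M Z by (intro assoc_mult_mat) auto
    also have "\<dots> $$ (i, i) = row (transpose_mat Z) i \<bullet> col (M * Z) i"
      using M Z that by (intro index_mult_mat) auto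
    also have "\<dots> = quad_form M (col Z i)"
      using M Z that by (simp add: quad_form_def col_mult2[of M q q Z k i])
    finally show ?thesis .
  qed
  then show ?thesis using Z by (auto simp: mat_trace_def intro!: sum.cong)
qed

lemma has_bochner_integral_affine_product:
  assumes "prob_space P" and X: "std_normal_vec P k X"
  shows "has_bochner_integral P
    (\<lambda>\<omega>. (c + (\<Sum>i<k. a i * X \<omega> $ i)) * (d + (\<Sum>j<k. b j * X \<omega> $ j)))
    (c * d + (\<Sum>i<k. a i * b i))"
proof -
  interpret prob_space P by fact
  note mom = std_normal_vec_moments[OF assms]
  \<comment> \<open>The expanded product is integrated term by term.\<close>
  have const: "has_bochner_integral P (\<lambda>\<omega>. c * d) (c * d)"
    by (simp add: has_bochner_integral_iff prob_space)
  have lin: "has_bochner_integral P (\<lambda>\<omega>. \<Sum>j<k. e * f j * X \<omega> $ j) (\<Sum>j<k. e * f j * 0)" for e and f :: "nat \<Rightarrow> real"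
    by (intro has_bochner_integral_sum has_bochner_integral_mult_right mom(1)) auto
  have quad: "has_bochner_integral P (\<lambda>\<omega>. \<Sum>i<k. \<Sum>j<k. a i * b j * (X \<omega> $ i * X \<omega> $ j))
      (\<Sum>i<k. \<Sum>j<k. a i * b j * (if i = j then 1 else 0))"
    by (intro has_bochner_integral_sum has_bochner_integral_mult_right mom(2)) auto
  note has_bochner_integral_add[OF has_bochner_integral_add[OF has_bochner_integral_add[OF const lin[of c b]] lin[of d a]] quad]
  moreover have "c * d + (\<Sum>j<k. c * b j * X \<omega> $ j) + (\<Sum>i<k. d * a i * X \<omega> $ i)
        + (\<Sum>i<k. \<Sum>j<k. a i * b j * (X \<omega> $ i * X \<omega> $ j))
      = (c + (\<Sum>i<k. a i * X \<omega> $ i)) * (d + (\<Sum>j<k. b j * X \<omega> $ j))" for \<omega>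
  proof -
    have "(\<Sum>i<k. a i * X \<omega> $ i) * (\<Sum>j<k. b j * X \<omega> $ j)
        = (\<Sum>i<k. \<Sum>j<k. a i * b j * (X \<omega> $ i * X \<omega> $ j))"
      unfolding sum_product by (intro sum.cong refl) (simp add: mult_ac)
    then show ?thesis
      by (simp only: distrib_left distrib_right) (simp add: sum_distrib_left mult_ac)
  qed
  moreover have "(\<Sum>i<k. \<Sum>j<k. a i * b j * (if i = j then 1 else 0)) = (\<Sum>i<k. a i * b i)"
    by (intro sum.cong refl) (simp add: if_distrib sum.delta cong: if_cong)
  ultimately show ?thesis
    by simp
qed

text \<open>
  A quadratic form is a combination of products of two affine functions of \<open>X\<close>. In the mean of each
  product the terms linear in \<open>X\<close> and the products of distinct coordinates vanish; what remains separates into a form in \<open>c\<close> and one form for each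
  column of \<open>Z\<close>.
\<close>

lemma has_bochner_integral_quad_form_affine:
  assumes "prob_space P" and X: "std_normal_vec P k X"
    and M: "M \<in> carrier_mat q q" and c: "c \<in> carrier_vec q" and Z: "Z \<in> carrier_mat q k"
  shows "has_bochner_integral P (\<lambda>\<omega>. quad_form M (c + Z *\<^sub>v X \<omega>))
    (quad_form M c + mat_trace (transpose_mat Z * M * Z))"
proof -
  let ?v = "\<lambda>a \<omega>. c $ a + (\<Sum>i<k. Z $$ (a, i) * X \<omega> $ i)"
  have *: "has_bochner_integral P (\<lambda>\<omega>. \<Sum>a<q. \<Sum>b<q. M $$ (a, b) * (?v a \<omega> * ?v b \<omega>))
      (\<Sum>a<q. \<Sum>b<q. M $$ (a, b) * (c $ a * c $ b + (\<Sum>i<k. Z $$ (a, i) * Z $$ (b, i))))"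
    by (intro has_bochner_integral_sum has_bochner_integral_mult_right
        has_bochner_integral_affine_product assms(1) X)
  have **: "quad_form M (c + Z *\<^sub>v X \<omega>) = (\<Sum>a<q. \<Sum>b<q. M $$ (a, b) * (?v a \<omega> * ?v b \<omega>))"
    if "\<omega> \<in> space P" for \<omega>
  proof -
    have x: "X \<omega> \<in> carrier_vec k" using X that by (simp add: std_normal_vec_def)
    have "(c + Z *\<^sub>v X \<omega>) $ a = ?v a \<omega>" if "a < q" for a
    proof -
      have "(Z *\<^sub>v X \<omega>) $ a = row Z a \<bullet> X \<omega>"
        using Z that by simp
      also have "\<dots> = (\<Sum>i<k. Z $$ (a, i) * X \<omega> $ i)"
        using Z x that by (simp add: scalar_prod_def atLeast0LessThan)
      finally show ?thesis
        using c Z that by simp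
    qed
    then show ?thesis
      using c Z x by (subst quad_form_eq_sum[OF M]) (auto intro!: sum.cong)
  qed
  have ***: "quad_form M c + mat_trace (transpose_mat Z * M * Z) =
    (\<Sum>a<q. \<Sum>b<q. M $$ (a, b) * (c $ a * c $ b + (\<Sum>i<k. Z $$ (a, i) * Z $$ (b, i))))"
  proof -
    have "mat_trace (transpose_mat Z * M * Z)
        = (\<Sum>i<k. \<Sum>a<q. \<Sum>b<q. M $$ (a, b) * (Z $$ (a, i) * Z $$ (b, i)))"
      unfolding mat_trace_eq_sum_quad_form[OF M Z]
      using Z by (intro sum.cong refl) (auto simp: quad_form_eq_sum[OF M] intro!: sum.cong)
    also have "\<dots> = (\<Sum>a<q. \<Sum>i<k. \<Sum>b<q. M $$ (a, b) * (Z $$ (a, i) * Z $$ (b, i)))"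
      by (rule sum.swap)
    also have "\<dots> = (\<Sum>a<q. \<Sum>b<q. \<Sum>i<k. M $$ (a, b) * (Z $$ (a, i) * Z $$ (b, i)))"
      by (intro sum.cong refl sum.swap)
    finally show ?thesis
      by (simp add: quad_form_eq_sum[OF M c] distrib_left sum.distrib sum_distrib_left)
  qed
  show ?thesis
    by (rule has_bochner_integral_cong[THEN iffD2, OF refl ** *** *])
qed

section \<open>States and inputs as affine functions of the noise\<close>

lemma Abar_carrier: "Abar n N A \<in> carrier_mat ((N + 1) * n) n"
  and Bbar_carrier: "Bbar n m N A B \<in> carrier_mat ((N + 1) * n) (N * m)"
  and Dbar_carrier: "Dbar n N A \<in> carrier_mat ((N + 1) * n) (N * n)"
  by (simp_all add: Abar_def Bbar_def Dbar_def block_mat_def)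

lemma add_vec_swap_middle:
  fixes a b c e :: "real vec"
  assumes "a \<in> carrier_vec q" "b \<in> carrier_vec q" "c \<in> carrier_vec q" "e \<in> carrier_vec q"
  shows "a + (b + c) + e = (a + c) + (b + e)"
  using assms by (intro eq_vecI) auto

context
  fixes n m N :: nat and A B G :: "real mat" and x0 d w :: "real vec"
  assumes x0: "x0 \<in> carrier_vec n" and G: "G \<in> carrier_mat (N * m) (N * n)"
    and d: "d \<in> carrier_vec (N * m)" and w: "w \<in> carrier_vec (N * n)"
begin

lemma x_theta_affine:
  "x_theta n m N A B x0 (G, d) w
    = (Abar n N A *\<^sub>v x0 + Bbar n m N A B *\<^sub>v d) + (Bbar n m N A B * G + Dbar n N A) *\<^sub>v w"
proof -
  let ?q = "(N + 1) * n"
  let ?A = "Abar n N A" and ?B = "Bbar n m N A B" and ?D = "Dbar n N A"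
  note c = Abar_carrier Bbar_carrier Dbar_carrier x0 G d w
  have B: "?B *\<^sub>v (G *\<^sub>v w + d) = (?B * G) *\<^sub>v w + ?B *\<^sub>v d"
    unfolding mult_add_distrib_mat_vec[OF Bbar_carrier mult_mat_vec_carrier[OF G w] d]
      assoc_mult_mat_vec[OF Bbar_carrier G w] ..
  have D: "(?B * G + ?D) *\<^sub>v w = (?B * G) *\<^sub>v w + ?D *\<^sub>v w"
    by (rule add_mult_distrib_mat_vec[OF mult_carrier_mat[OF Bbar_carrier G] Dbar_carrier w])
  have v: "?A *\<^sub>v x0 \<in> carrier_vec ?q" "(?B * G) *\<^sub>v w \<in> carrier_vec ?q"
      "?B *\<^sub>v d \<in> carrier_vec ?q" "?D *\<^sub>v w \<in> carrier_vec ?q"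
    using c by (blast intro: mult_mat_vec_carrier mult_carrier_mat)+
  show ?thesis
    unfolding x_theta_def u_theta_def fst_conv snd_conv B D
    by (rule add_vec_swap_middle[OF v])
qed

lemma state_input_affine:
  "x_theta n m N A B x0 (G, d) w @\<^sub>v u_theta (G, d) w
    = ((Abar n N A *\<^sub>v x0 + Bbar n m N A B *\<^sub>v d) @\<^sub>v d)
      + ((Bbar n m N A B * G + Dbar n N A) @\<^sub>r G) *\<^sub>v w"
proof -
  let ?q = "(N + 1) * n"
  let ?c = "Abar n N A *\<^sub>v x0 + Bbar n m N A B *\<^sub>v d" and ?Z = "Bbar n m N A B * G + Dbar n N A"
  have Z: "?Z \<in> carrier_mat ?q (N * n)"
    by (rule add_carrier_mat[OF Dbar_carrier])
  have c: "?c \<in> carrier_vec ?q"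
    by (rule add_carrier_vec[OF mult_mat_vec_carrier[OF Abar_carrier x0] mult_mat_vec_carrier[OF Bbar_carrier d]])
  have u: "u_theta (G, d) w = d + G *\<^sub>v w"
    using G d w by (auto simp: u_theta_def intro!: comm_add_vec[of _ "N * m"] mult_mat_vec_carrier)
  have v: "?Z *\<^sub>v w \<in> carrier_vec ?q" "G *\<^sub>v w \<in> carrier_vec (N * m)"
    by (rule mult_mat_vec_carrier[OF Z w] mult_mat_vec_carrier[OF G w])+
  show ?thesis
    unfolding x_theta_affine u mat_mult_append[OF Z G w]
    by (rule append_vec_add[OF c v(1) d v(2), symmetric])
qed

lemma constraint_affine:
  assumes Tx: "Tx \<in> carrier_mat 1 ((N + 1) * n)" and Tu: "Tu \<in> carrier_mat 1 (N * m)"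
  shows "(Tx *\<^sub>v x_theta n m N A B x0 (G, d) w) $ 0 + (Tu *\<^sub>v u_theta (G, d) w) $ 0 - y
    = mu_fun n m N A B x0 Tx Tu y d
      + col (transpose_mat (Tx * Dbar n N A + (Tx * Bbar n m N A B + Tu) * G)) 0 \<bullet> w"
proof -
  let ?q = "(N + 1) * n" and ?k = "N * n" and ?p = "N * m"
  let ?A = "Abar n N A" and ?B = "Bbar n m N A B" and ?D = "Dbar n N A"
  let ?R = "Tx * ?D + (Tx * ?B + Tu) * G"
  note c = Abar_carrier Bbar_carrier Dbar_carrier x0 G d w Tx Tu
  have TB: "Tx * ?B \<in> carrier_mat 1 ?p" "Tx * ?D \<in> carrier_mat 1 ?k"
      "(Tx * ?B + Tu) * G \<in> carrier_mat 1 ?k" "?R \<in> carrier_mat 1 ?k"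
    using c by (blast intro: mult_carrier_mat add_carrier_mat)+
  have Gw: "G *\<^sub>v w \<in> carrier_vec ?p" and u: "u_theta (G, d) w \<in> carrier_vec ?p"
    using c by (auto simp: u_theta_def intro!: mult_mat_vec_carrier add_carrier_vec)
  have vecs: "?A *\<^sub>v x0 \<in> carrier_vec ?q" "?B *\<^sub>v u_theta (G, d) w \<in> carrier_vec ?q" "?D *\<^sub>v w \<in> carrier_vec ?q"
    using c u by (blast intro: mult_mat_vec_carrier)+
  have "Tx *\<^sub>v x_theta n m N A B x0 (G, d) w
      = (Tx * ?A) *\<^sub>v x0 + (Tx * ?B) *\<^sub>v u_theta (G, d) w + (Tx * ?D) *\<^sub>v w"
    unfolding x_theta_def mult_add_distrib_mat_vec[OF Tx add_carrier_vec[OF vecs(1,2)] vecs(3)]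
      mult_add_distrib_mat_vec[OF Tx vecs(1,2)] assoc_mult_mat_vec[OF Tx Abar_carrier x0]
      assoc_mult_mat_vec[OF Tx Bbar_carrier u] assoc_mult_mat_vec[OF Tx Dbar_carrier w] ..
  then have 1: "(Tx *\<^sub>v x_theta n m N A B x0 (G, d) w) $ 0
      = ((Tx * ?A) *\<^sub>v x0) $ 0 + ((Tx * ?B) *\<^sub>v u_theta (G, d) w) $ 0 + ((Tx * ?D) *\<^sub>v w) $ 0"
    using Tx by simp
  have "(Tx * ?B + Tu) *\<^sub>v u_theta (G, d) w = (Tx * ?B) *\<^sub>v u_theta (G, d) w + Tu *\<^sub>v u_theta (G, d) w"
    by (rule add_mult_distrib_mat_vec[OF TB(1) Tu u])
  then have 2: "((Tx * ?B + Tu) *\<^sub>v u_theta (G, d) w) $ 0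
      = ((Tx * ?B) *\<^sub>v u_theta (G, d) w) $ 0 + (Tu *\<^sub>v u_theta (G, d) w) $ 0"
    using Tu by simp
  have S: "Tx * ?B + Tu \<in> carrier_mat 1 ?p"
    by (rule add_carrier_mat[OF Tu])
  have "(Tx * ?B + Tu) *\<^sub>v u_theta (G, d) w = ((Tx * ?B + Tu) * G) *\<^sub>v w + (Tx * ?B + Tu) *\<^sub>v d"
    unfolding u_theta_def fst_conv snd_conv mult_add_distrib_mat_vec[OF S Gw d]
      assoc_mult_mat_vec[OF S G w] ..
  then have 3: "((Tx * ?B + Tu) *\<^sub>v u_theta (G, d) w) $ 0
      = (((Tx * ?B + Tu) * G) *\<^sub>v w) $ 0 + ((Tx * ?B + Tu) *\<^sub>v d) $ 0"
    using Tu by simp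
  have "?R *\<^sub>v w = (Tx * ?D) *\<^sub>v w + ((Tx * ?B + Tu) * G) *\<^sub>v w"
    by (rule add_mult_distrib_mat_vec[OF TB(2,3) w])
  then have 4: "(?R *\<^sub>v w) $ 0 = ((Tx * ?D) *\<^sub>v w) $ 0 + (((Tx * ?B + Tu) * G) *\<^sub>v w) $ 0"
    using Tu by simp
  have 5: "(?R *\<^sub>v w) $ 0 = col (transpose_mat ?R) 0 \<bullet> w"
    using TB(4) Tu by simp
  show ?thesis
    unfolding mu_fun_def using 1 2 3 4 5 by linarith
qed

end

section \<open>Equivalence of the two problems\<close>

text \<open>
  Minimizers and the optimal value depend on the objective and the constraint only through their
  values on \<open>S\<close>.
\<close>

lemma equiv_min_problemsI:
  assumes "\<And>\<theta>. \<theta> \<in> S \<Longrightarrow> C \<theta> \<longleftrightarrow> C' \<theta>" and "\<And>\<theta>. \<theta> \<in> S \<Longrightarrow> f \<theta> = f' \<theta>"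
  shows "equiv_min_problems S f C f' C'"
proof -
  have "{\<theta> \<in> S. C \<theta>} = {\<theta> \<in> S. C' \<theta>}" using assms(1) by auto
  moreover have "is_arg_min f (\<lambda>\<theta>. \<theta> \<in> S \<and> C \<theta>) \<theta> \<longleftrightarrow> is_arg_min f' (\<lambda>\<theta>. \<theta> \<in> S \<and> C' \<theta>) \<theta>" for \<theta>
    using assms unfolding is_arg_min_def by metis
  ultimately show ?thesis
    using assms by (auto simp: equiv_min_problems_def intro!: INF_cong)
qed

theorem proposition17:
  fixes n m N :: nat
    and A B M Tx Tu :: "real mat"
    and x0 :: "real vec"
    and y \<beta> :: real
    and P :: "'a measure"
    and w :: "nat \<Rightarrow> 'a \<Rightarrow> real vec"
  defines "wbar \<equiv> \<lambda>\<omega>. stack_vec N n (\<lambda>t. w t \<omega>)"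
  assumes "n \<ge> 1" and "m \<ge> 1" and "N \<ge> 1"
    and "A \<in> carrier_mat n n" and "B \<in> carrier_mat n m" and "x0 \<in> carrier_vec n"
    and "prob_space P"
    and "\<And>t \<omega>. t < N \<Longrightarrow> \<omega> \<in> space P \<Longrightarrow> w t \<omega> \<in> carrier_vec n"
    and "std_normal_vec P (N * n) wbar"
    and "sym_psd ((N + 1) * n + N * m) M"
    and "Tx \<in> carrier_mat 1 ((N + 1) * n)" and "Tu \<in> carrier_mat 1 (N * m)"
    and "\<beta> > 0"
  shows "(\<forall>\<theta>\<in>Theta n m N.
            integrable P (\<lambda>\<omega>. cost n m N A B x0 M \<theta> (wbar \<omega>)) \<and>
            integrable P (\<lambda>\<omega>. violation n m N A B x0 Tx Tu y \<theta> (wbar \<omega>))) \<and>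
         equiv_min_problems (Theta n m N)
           (\<lambda>\<theta>. prob_space.expectation P (\<lambda>\<omega>. cost n m N A B x0 M \<theta> (wbar \<omega>)))
           (\<lambda>\<theta>. prob_space.expectation P (\<lambda>\<omega>. violation n m N A B x0 Tx Tu y \<theta> (wbar \<omega>)) \<le> \<beta>)
           (\<lambda>\<theta>. h1 n m N A B x0 M (snd \<theta>) + h2 n m N A B M (fst \<theta>))
           (\<lambda>\<theta>. sigma_g (mu_fun n m N A B x0 Tx Tu y (snd \<theta>)) (sigma_fun n m N A B Tx Tu (fst \<theta>)) \<le> \<beta>)"
proof -
  have P: "prob_space P" and X: "std_normal_vec P (N * n) wbar" and x0: "x0 \<in> carrier_vec n"
    and M: "M \<in> carrier_mat ((N + 1) * n + N * m) ((N + 1) * n + N * m)"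
    and Tx: "Tx \<in> carrier_mat 1 ((N + 1) * n)" and Tu: "Tu \<in> carrier_mat 1 (N * m)"
    using assms by (auto simp: sym_psd_def)
  have w: "wbar \<omega> \<in> carrier_vec (N * n)" if "\<omega> \<in> space P" for \<omega>
    using X that by (simp add: std_normal_vec_def)
  have cost: "has_bochner_integral P (\<lambda>\<omega>. cost n m N A B x0 M \<theta> (wbar \<omega>))
      (h1 n m N A B x0 M (snd \<theta>) + h2 n m N A B M (fst \<theta>))"
    and violation: "has_bochner_integral P (\<lambda>\<omega>. violation n m N A B x0 Tx Tu y \<theta> (wbar \<omega>))
      (sigma_g (mu_fun n m N A B x0 Tx Tu y (snd \<theta>)) (sigma_fun n m N A B Tx Tu (fst \<theta>)))"
    if in_Theta: "\<theta> \<in> Theta n m N" for \<theta>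
  proof -
    obtain G d where \<theta>: "\<theta> = (G, d)" and G: "G \<in> carrier_mat (N * m) (N * n)" and d: "d \<in> carrier_vec (N * m)"
      using in_Theta by (auto simp: Theta_def)
    let ?c = "(Abar n N A *\<^sub>v x0 + Bbar n m N A B *\<^sub>v d) @\<^sub>v d"
      and ?Z = "(Bbar n m N A B * G + Dbar n N A) @\<^sub>r G"
      and ?r = "col (transpose_mat (Tx * Dbar n N A + (Tx * Bbar n m N A B + Tu) * G)) 0"
    have c: "?c \<in> carrier_vec ((N + 1) * n + N * m)"
      by (intro append_carrier_vec add_carrier_vec mult_mat_vec_carrier[OF Abar_carrier x0]
          mult_mat_vec_carrier[OF Bbar_carrier d] d)
    have Z: "?Z \<in> carrier_mat ((N + 1) * n + N * m) (N * n)"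
      by (intro carrier_append_rows add_carrier_mat Dbar_carrier G)
    have r: "?r \<in> carrier_vec (N * n)"
      by (rule carrier_vecI) (use G in simp)
    show "has_bochner_integral P (\<lambda>\<omega>. cost n m N A B x0 M \<theta> (wbar \<omega>))
        (h1 n m N A B x0 M (snd \<theta>) + h2 n m N A B M (fst \<theta>))"
    proof (rule has_bochner_integral_cong[THEN iffD2, OF refl _ _ has_bochner_integral_quad_form_affine[OF P X M c Z]])
      show "cost n m N A B x0 M \<theta> (wbar \<omega>) = quad_form M (?c + ?Z *\<^sub>v wbar \<omega>)" if "\<omega> \<in> space P" for \<omega>
        unfolding cost_def \<theta> state_input_affine[OF x0 G d w[OF that]] ..
      show "h1 n m N A B x0 M (snd \<theta>) + h2 n m N A B M (fst \<theta>)
          = quad_form M ?c + mat_trace (transpose_mat ?Z * M * ?Z)"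
        by (simp add: \<theta> h1_def h2_def Let_def)
    qed
    show "has_bochner_integral P (\<lambda>\<omega>. violation n m N A B x0 Tx Tu y \<theta> (wbar \<omega>))
        (sigma_g (mu_fun n m N A B x0 Tx Tu y (snd \<theta>)) (sigma_fun n m N A B Tx Tu (fst \<theta>)))"
    proof (rule has_bochner_integral_cong[THEN iffD2, OF refl _ _ has_bochner_integral_phi_std_normal_vec[OF P X r]])
      show "violation n m N A B x0 Tx Tu y \<theta> (wbar \<omega>) = phi (mu_fun n m N A B x0 Tx Tu y d + ?r \<bullet> wbar \<omega>)"
        if "\<omega> \<in> space P" for \<omega>
        unfolding violation_def \<theta> constraint_affine[OF x0 G d w[OF that] Tx Tu] ..
      show "sigma_g (mu_fun n m N A B x0 Tx Tu y (snd \<theta>)) (sigma_fun n m N A B Tx Tu (fst \<theta>))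
          = sigma_g (mu_fun n m N A B x0 Tx Tu y d) (l2norm_vec ?r)"
        by (simp add: \<theta> sigma_fun_def)
    qed
  qed
  show ?thesis
    using cost violation
    by (auto simp: has_bochner_integral_iff intro!: equiv_min_problemsI)
qed

end
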